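(* Let $r\ge 1$ and let $0<\lambda_1<\lambda_2<\cdots<\lambda_r$ be integers. Let $C=(c_{ij})$ be the $r\times r$ matrix with $c_{ij}=\min\{\lambda_i,\lambda_j\}$, that is, $$C=\begin{pmatrix}\lambda_1&\lambda_1&\lambda_1&\cdots&\lambda_1\\ \lambda_1&\lambda_2&\lambda_2&\cdots&\lambda_2\\ \lambda_1&\lambda_2&\lambda_3&\cdots&\lambda_3\\ \vdots&\vdots&\vdots&\ddots&\vdots\\ \lambda_1&\lambda_2&\lambda_3&\cdots&\lambda_r\end{pmatrix}.$$ Then $$\det C=\lambda_1(\lambda_2-\lambda_1)\cdots(\lambda_r-\lambda_{r-1}).$$
   Context: The integers $\lambda_1<\cdots<\lambda_r$ are the distinct parts of a partition. *)

theory Defs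
  imports Main "Jordan_Normal_Form.Determinant"
begin

(* Matrix rows and columns are counted from 0, the parts lam 1 < ... < lam r from 1. *)
definition min_mat :: "nat \<Rightarrow> (nat \<Rightarrow> int) \<Rightarrow> int mat" where
  "min_mat r lam = mat r r (\<lambda>(i, j). min (lam (i + 1)) (lam (j + 1)))"

end

theory Submission imports Defs begin

text \<open>With \<open>d\<^sub>0 = \<lambda>\<^sub>1\<close> and \<open>d\<^sub>k = \<lambda>\<^sub>k\<^sub>+\<^sub>1 - \<lambda>\<^sub>k\<close>, the entry \<open>min \<lambda>\<^sub>i \<lambda>\<^sub>j\<close> telescopes to the sum of
  the \<open>d\<^sub>k\<close> with \<open>k < min i j\<close>. Hence \<open>C = L * U\<close>, where \<open>L\<close> is the lower triangular matrix of ones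
  and \<open>U\<close> is upper triangular with all nonzero entries of row \<open>k\<close> equal to \<open>d\<^sub>k\<close>.\<close>

text \<open>Computes an entry of \<open>L * U\<close>: both conditions hold exactly when
  \<open>k \<le> min i j\<close>, and \<open>i < n\<close> keeps all such \<open>k\<close> in the
  range of summation.\<close>

lemma sum_if_le_both:
  fixes d :: "nat \<Rightarrow> 'a :: semiring_1"
  assumes "i < n"
  shows "(\<Sum>k = 0..<n. (if k \<le> i then 1 else 0) * (if k \<le> j then d k else 0)) = sum d {..min i j}"
proof -
  have "(\<Sum>k = 0..<n. (if k \<le> i then 1 else 0) * (if k \<le> j then d k else 0))
      = (\<Sum>k = 0..<n. if k \<in> {..min i j} then d k else 0)"
    by (intro sum.cong) auto
  also have "\<dots> = sum d ({0..<n} \<inter> {..min i j})"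
    by (simp only: sum.inter_restrict finite_atLeastLessThan)
  also have "{0..<n} \<inter> {..min i j} = {..min i j}"
    using assms by auto
  finally show ?thesis .
qed

lemma det_mat_sum_atMost_min:
  fixes d :: "nat \<Rightarrow> 'a :: idom"
  shows "det (mat n n (\<lambda>(i, j). sum d {..min i j})) = (\<Prod>k = 0..<n. d k)"
proof -
  define L :: "'a mat" where "L = mat n n (\<lambda>(i, k). if k \<le> i then 1 else 0)"
  define U where "U = mat n n (\<lambda>(k, j). if k \<le> j then d k else 0)"
  have L: "L \<in> carrier_mat n n" and U: "U \<in> carrier_mat n n"
    by (simp_all add: L_def U_def)
  have "mat n n (\<lambda>(i, j). sum d {..min i j}) = L * U"
    by (rule eq_matI) (auto simp: L_def U_def scalar_prod_def sum_if_le_both)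
  moreover have "det L = 1"
    by (subst det_lower_triangular[OF _ L]) (auto simp: L_def prod_list_diag_prod)
  moreover have "det U = (\<Prod>k = 0..<n. d k)"
    by (subst det_upper_triangular[OF _ U]) (auto simp: U_def prod_list_diag_prod upper_triangular_def)
  ultimately show ?thesis
    by (simp add: det_mult[OF L U])
qed

theorem lemma9p1:
  fixes r :: nat and lam :: "nat \<Rightarrow> int"
  assumes "r \<ge> 1"
    and "0 < lam 1"
    and "strict_mono_on {1..r} lam"
  shows "det (min_mat r lam) = lam 1 * (\<Prod>i = 2..r. lam i - lam (i - 1))"
proof -
  \<comment> \<open>Parts are counted from 1 and \<open>lam 0\<close> is arbitrary, so
    \<open>d 0\<close> is set apart to start the telescoping.\<close>
  define d where "d k = (if k = 0 then lam 1 else lam (k + 1) - lam k)" for k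
  have telescope: "sum d {..m} = lam (m + 1)" for m
    by (induction m) (simp_all add: d_def)
  \<comment> \<open>Monotonicity of \<open>lam\<close> moves the minimum from the parts to their
    indices.\<close>
  have min_lam: "min (lam (i + 1)) (lam (j + 1)) = lam (min i j + 1)" if "i < r" "j < r" for i j
  proof -
    have "lam (a + 1) \<le> lam (b + 1)" if "a \<le> b" "b < r" for a b
      using strict_mono_on_leD[OF assms(3), of "a + 1" "b + 1"] that by simp
    then show ?thesis
      using that by (cases "i \<le> j") (simp_all add: min_absorb1 min_absorb2)
  qed
  have "min_mat r lam = mat r r (\<lambda>(i, j). sum d {..min i j})"
    unfolding min_mat_def by (rule eq_matI) (simp_all only: telescope min_lam index_mat dim_row_mat dim_col_mat split)
  then have "det (min_mat r lam) = (\<Prod>k = 0..<r. d k)"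
    by (simp only: det_mat_sum_atMost_min)
  also have "\<dots> = d 0 * (\<Prod>k = 1..<r. d k)"
    using assms(1) by (simp add: prod.atLeast_Suc_lessThan)
  \<comment> \<open>The shift \<open>i = k + 1\<close> passes from matrix indices to those of the
    parts.\<close>
  also have "(\<Prod>k = 1..<r. d k) = (\<Prod>i = 2..r. lam i - lam (i - 1))"
    by (rule prod.reindex_bij_witness[of _ "\<lambda>i. i - 1" "\<lambda>k. k + 1"]) (auto simp: d_def)
  finally show ?thesis
    by (simp add: d_def)
qed

end
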